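(* Let $f:\mathbb{R}\to\mathbb{R}$ be a continuous periodic function and let $\alpha\in\mathbb{R}$ be irrational. Then the sequence $\{n\alpha+f(n)\}_{n=1}^\infty$ is dense in $[0,1)$ (mod 1).
   Context: A real sequence $(x_n)_{n\ge1}$ is dense in $[0,1)$ (mod 1) if the set of fractional parts of the $x_n$ is dense in $[0,1)$. In $\{n\alpha+f(n)\}_{n=1}^\infty$ the braces denote the sequence, not fractional part. *)

theory Defs
  imports "HOL-Analysis.Analysis"
begin

text \<open>Sequences are indexed from 1; the value \<open>x 0\<close> is ignored. All fractional parts lie
  in \<open>{0..<1}\<close>, so the set of them is dense in that subspace iff its closure contains it.\<close>

definition dense_mod_one :: "(nat \<Rightarrow> real) \<Rightarrow> bool" where
  "dense_mod_one x \<longleftrightarrow> {0..<1} \<subseteq> closure {frac (x n) | n. n \<ge> 1}"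

definition periodic :: "(real \<Rightarrow> real) \<Rightarrow> bool" where
  "periodic f \<longleftrightarrow> (\<exists>T>0. \<forall>t. f (t + T) = f t)"

end

theory Submission
  imports Defs "HOL-Library.Periodic_Fun"
begin

text \<open>Let \<open>T\<close> be a period of \<open>f\<close>. By Dirichlet's simultaneous approximation theorem there is
  \<open>m > 0\<close> such that \<open>m \<alpha>\<close> and \<open>m / T\<close> differ from integers by arbitrarily small \<open>u\<close> and \<open>v\<close>;
  \<open>u\<close> is nonzero as \<open>\<alpha>\<close> is irrational. Along the multiples of \<open>m\<close> the sequence is congruent
  modulo 1 to \<open>h k = k u + f (k v T)\<close>. By uniform continuity of \<open>f\<close> the real sequence \<open>h\<close> has small
  steps, and it tends to \<open>\<plusminus>\<infinity>\<close> since \<open>f\<close> is bounded, so it comes close to some integer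
  translate of every real number.\<close>

lemma periodic_shift_int:
  fixes f :: "real \<Rightarrow> 'a"
  assumes "\<And>t. f (t + T) = f t"
  shows "f (t + of_int k * T) = f t"
proof -
  interpret periodic_fun_simple f T
    by standard (rule assms)
  show ?thesis
    by (rule plus_of_int)
qed

lemma periodic_reduce:
  fixes T s :: real
  assumes "T > 0"
  obtains k :: int where "s + of_int k * T \<in> {0..T}"
proof
  show "s + of_int (- \<lfloor>s / T\<rfloor>) * T \<in> {0..T}"
    using floor_divide_lower[OF assms, of s] floor_divide_upper[OF assms, of s]
    by (simp add: algebra_simps)
qed

lemma continuous_periodic_bounded:
  fixes f :: "real \<Rightarrow> 'a::real_normed_vector"
  assumes "continuous_on UNIV f" "T > 0" "\<And>t. f (t + T) = f t"
  shows "bounded (range f)"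
proof -
  have "compact (f ` {0..T})"
    using assms(1) by (intro compact_continuous_image) (auto intro: continuous_on_subset)
  moreover have "range f \<subseteq> f ` {0..T}"
  proof (intro image_subsetI)
    fix s
    obtain k :: int where "s + of_int k * T \<in> {0..T}"
      using periodic_reduce assms(2) by blast
    then show "f s \<in> f ` {0..T}"
      by (metis image_eqI periodic_shift_int[of f, OF assms(3)])
  qed
  ultimately show ?thesis
    using bounded_subset compact_imp_bounded by blast
qed

lemma continuous_periodic_uniformly_continuous:
  fixes f :: "real \<Rightarrow> 'a::metric_space"
  assumes "continuous_on UNIV f" "T > 0" and per: "\<And>t. f (t + T) = f t"
  shows "uniformly_continuous_on UNIV f"
  unfolding uniformly_continuous_on_def
proof (intro allI impI)
  fix e :: real assume "e > 0"
  \<comment> \<open>One spare period on each side of \<open>{0..T}\<close>: once \<open>x\<close> is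
    shifted into \<open>{0..T}\<close>, a point \<open>x'\<close> closer than \<open>T\<close> is
    shifted into the larger interval.\<close>
  have "uniformly_continuous_on {-T..2 * T} f"
    using assms(1) by (intro compact_uniformly_continuous) (auto intro: continuous_on_subset)
  then obtain d where "d > 0" and d: "\<And>x x'. x \<in> {-T..2 * T} \<Longrightarrow> x' \<in> {-T..2 * T} \<Longrightarrow>
      dist x' x < d \<Longrightarrow> dist (f x') (f x) < e"
    unfolding uniformly_continuous_on_def using \<open>e > 0\<close> by meson
  have "dist (f x') (f x) < e" if "dist x' x < min d T" for x x'
  proof -
    obtain k :: int where "x + of_int k * T \<in> {0..T}"
      using periodic_reduce assms(2) by blast
    then have "dist (f (x' + of_int k * T)) (f (x + of_int k * T)) < e"
      using that assms(2) by (intro d) (auto simp: dist_real_def)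
    then show ?thesis
      by (simp add: periodic_shift_int[of f, OF per])
  qed
  then show "\<exists>d>0. \<forall>x\<in>UNIV. \<forall>x'\<in>UNIV. dist x' x < d \<longrightarrow> dist (f x') (f x) < e"
    using \<open>d > 0\<close> assms(2) by (intro exI[of _ "min d T"]) auto
qed

text \<open>At the first index where \<open>h\<close> reaches \<open>c\<close>, the preceding value
  is still below \<open>c\<close>, so the overshoot is less than one step. This index is positive
  because \<open>h\<close> starts below \<open>c\<close>.\<close>

lemma discrete_IVT:
  fixes h :: "nat \<Rightarrow> real"
  assumes "filterlim h at_top sequentially" "\<And>k. h (Suc k) < h k + e" "h 0 < c"
  obtains k where "k > 0" "\<bar>h k - c\<bar> < e"
proof -
  have "\<exists>k. h k \<ge> c"
    using assms(1) by (auto simp: filterlim_at_top eventually_sequentially)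
  then obtain k where "h k \<ge> c" and least: "\<And>j. j < k \<Longrightarrow> h j < c"
    using exists_least_iff[of "\<lambda>k. h k \<ge> c"] by (auto simp: not_le)
  then obtain j where "k = Suc j"
    using assms(3) by (cases k) auto
  with least[of j] assms(2)[of j] \<open>h k \<ge> c\<close> have "\<bar>h k - c\<bar> < e"
    by simp
  with \<open>k = Suc j\<close> that show ?thesis
    by blast
qed

lemma small_steps_near_int_translate:
  fixes g :: "nat \<Rightarrow> real"
  assumes "u \<noteq> 0" "bounded (range g)"
    and step: "\<And>k. \<bar>u\<bar> + \<bar>g (Suc k) - g k\<bar> < e"
  obtains k and j :: int where "k > 0" "\<bar>real k * u + g k - (y + of_int j)\<bar> < e"
proof -
  \<comment> \<open>Multiplying by the sign of \<open>u\<close> makes the drift positive, so only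
    divergence to plus infinity has to be treated.\<close>
  define s where "s = sgn u"
  define h where "h = (\<lambda>k. s * (real k * u + g k))"
  have s: "s = 1 \<or> s = -1"
    using assms(1) by (auto simp: s_def sgn_if)
  have h: "h k = real k * \<bar>u\<bar> + s * g k" for k
    by (simp add: h_def s_def abs_sgn algebra_simps)
  obtain B where B: "\<And>k. \<bar>g k\<bar> \<le> B"
    using assms(2) by (auto simp: bounded_iff)
  have "filterlim (\<lambda>k. - B + real k * \<bar>u\<bar>) at_top sequentially"
    using assms(1) by (intro filterlim_tendsto_add_at_top[OF tendsto_const]
        filterlim_at_top_mult_tendsto_pos[OF tendsto_const _ filterlim_real_sequentially]) simp
  moreover have "- B + real k * \<bar>u\<bar> \<le> h k" for k
    using s B[of k] by (auto simp: h abs_le_iff)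
  ultimately have lim: "filterlim h at_top sequentially"
    by (auto intro: filterlim_at_top_mono)
  have h_step: "h (Suc k) < h k + e" for k
    using step[of k] s by (auto simp: h algebra_simps)
  \<comment> \<open>The target \<open>s * y\<close> is raised by an integer to lie above the
    starting value \<open>h 0\<close>.\<close>
  obtain n :: nat where "real n > h 0 - s * y"
    using reals_Archimedean2 by blast
  then have "h 0 < s * y + real n"
    by simp
  from discrete_IVT[OF lim h_step this] obtain k where "k > 0" "\<bar>h k - (s * y + real n)\<bar> < e" .
  \<comment> \<open>Since \<open>s * s = 1\<close>, removing the factor \<open>s\<close> turns the
    translate by \<open>n\<close> into one by \<open>s * n\<close>.\<close>
  then have "\<bar>real k * u + g k - (y + of_int (if s = 1 then int n else - int n))\<bar> < e"
    using s by (auto simp: h_def)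
  with \<open>k > 0\<close> that show ?thesis
    by blast
qed

lemma dense_mod_oneI:
  assumes "\<And>y e. \<lbrakk>0 < y; y < 1; 0 < e\<rbrakk> \<Longrightarrow> \<exists>n\<ge>1. \<exists>j::int. \<bar>x n - (y + of_int j)\<bar> < e"
  shows "dense_mod_one x"
proof -
  let ?S = "{frac (x n) | n. n \<ge> 1}"
  have "y \<in> closure ?S" if "y \<in> {0<..<1}" for y
    unfolding closure_approachable
  proof (intro allI impI)
    fix e :: real assume "e > 0"
    \<comment> \<open>An error below \<open>y\<close> and \<open>1 - y\<close> keeps
      \<open>x n\<close> strictly between \<open>j\<close> and \<open>j + 1\<close>, so its
      fractional part cannot wrap around.\<close>
    with that assms[of y "min e (min y (1 - y))"]
    obtain n and j :: int where n: "n \<ge> 1" "\<bar>x n - (y + of_int j)\<bar> < min e (min y (1 - y))"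
      by auto
    then have "\<lfloor>x n\<rfloor> = j"
      by (intro floor_unique) auto
    with n have "dist (frac (x n)) y < e"
      by (simp add: frac_def dist_real_def diff_diff_eq add.commute)
    with n(1) show "\<exists>z\<in>?S. dist z y < e"
      by blast
  qed
  \<comment> \<open>Taking the closure recovers the endpoint 0, which was excluded above.\<close>
  then have "closure {0<..<1} \<subseteq> closure ?S"
    by (intro closure_minimal) auto
  then show ?thesis
    by (auto simp: dense_mod_one_def)
qed

theorem theorem1p1:
  fixes f :: "real \<Rightarrow> real" and \<alpha> :: real
  assumes "continuous_on UNIV f"
    and "periodic f"
    and "\<alpha> \<notin> \<rat>"
  shows "dense_mod_one (\<lambda>n. real n * \<alpha> + f (real n))"
proof (rule dense_mod_oneI)
  fix y e :: real assume "e > 0"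
  obtain T where T: "T > 0" and per: "\<And>t. f (t + T) = f t"
    using assms(2) by (auto simp: periodic_def)
  have "uniformly_continuous_on UNIV f"
    using continuous_periodic_uniformly_continuous assms(1) T per .
  then obtain d where "d > 0" and d: "\<And>s t. \<bar>s - t\<bar> < d \<Longrightarrow> \<bar>f s - f t\<bar> < e / 2"
    unfolding uniformly_continuous_on_def dist_real_def
    by (metis UNIV_I \<open>e > 0\<close> half_gt_zero)
  \<comment> \<open>The bound \<open>e / 2\<close> on \<open>u\<close> leaves \<open>e / 2\<close>
    for the variation of \<open>f\<close>; the bound \<open>d / T\<close> on \<open>v\<close> makes
    the shift \<open>v * T\<close> of the argument smaller than \<open>d\<close>.\<close>
  define \<delta> where "\<delta> = min (e / 2) (d / T)"
  have "\<delta> > 0"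
    using \<open>e > 0\<close> \<open>d > 0\<close> T by (simp add: \<delta>_def)
  then obtain N :: nat where "N > 0" and N: "1 / real N < \<delta>"
    by (metis inverse_eq_divide reals_Archimedean zero_less_Suc)
  obtain m and p :: "nat \<Rightarrow> int" where "m > 0"
    and approx: "\<And>i. i < 2 \<Longrightarrow> \<bar>of_int m * (if i = 0 then \<alpha> else 1 / T) - of_int (p i)\<bar> < 1 / N"
    using Dirichlet_approx_simult[OF \<open>N > 0\<close>, of 2 "\<lambda>i. if i = 0 then \<alpha> else 1 / T"] by metis
  define u where "u = of_int m * \<alpha> - of_int (p 0)"
  define v where "v = of_int m / T - of_int (p 1)"
  have u: "\<bar>u\<bar> < e / 2" and "\<bar>v\<bar> < d / T"
    using approx[of 0] approx[of 1] N by (auto simp: u_def v_def \<delta>_def)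
  then have v: "\<bar>v * T\<bar> < d"
    using T by (simp add: abs_mult pos_less_divide_eq)
  have "u \<noteq> 0"
  proof
    assume "u = 0"
    then have "\<alpha> = of_int (p 0) / of_int m"
      using \<open>m > 0\<close> by (simp add: u_def field_simps)
    with assms(3) show False
      by simp
  qed
  moreover have "bounded (range (\<lambda>k::nat. f (real k * (v * T))))"
    using continuous_periodic_bounded[OF assms(1) T per] by (rule bounded_subset) auto
  moreover have "\<bar>u\<bar> + \<bar>f (real (Suc k) * (v * T)) - f (real k * (v * T))\<bar> < e" for k
    using u d[of "real (Suc k) * (v * T)" "real k * (v * T)"] v by (simp add: algebra_simps)
  ultimately obtain k and j :: int
    where "k > 0" and kj: "\<bar>real k * u + f (real k * (v * T)) - (y + of_int j)\<bar> < e"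
    by (rule small_steps_near_int_translate)
  define n where "n = k * nat m"
  have n: "real n = real k * of_int m"
    using \<open>m > 0\<close> by (simp add: n_def)
  \<comment> \<open>By definition of \<open>v\<close>, \<open>m = v * T + p 1 * T\<close>, so
    \<open>n\<close> and \<open>k * (v * T)\<close> differ by an integer number of periods.\<close>
  have "real n = real k * (v * T) + of_int (int k * p 1) * T"
    using T by (simp add: n v_def field_simps)
  then have "f (real n) = f (real k * (v * T))"
    using periodic_shift_int[of f, OF per] by metis
  moreover have "real n * \<alpha> = real k * u + of_int (int k * p 0)"
    by (simp add: n u_def algebra_simps)
  ultimately have "\<bar>real n * \<alpha> + f (real n) - (y + of_int (j + int k * p 0))\<bar> < e"
    using kj by (simp add: algebra_simps)
  moreover have "n \<ge> 1"
    using \<open>k > 0\<close> \<open>m > 0\<close> by (simp add: n_def)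
  ultimately show "\<exists>n\<ge>1. \<exists>j::int. \<bar>real n * \<alpha> + f (real n) - (y + of_int j)\<bar> < e"
    by blast
qed

end
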